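(* Let $d\ge3$. If the collection of all convex bodies in $\mathbb{R}^{d-1}$ has infinite VC dimension, then there is a symmetric convex body $F\subset\mathbb{R}^d$ such that the family $\{\lambda F+r:\lambda>0,\ r\in\mathbb{R}^d\}$ has infinite VC dimension.
   Context: A convex body in $\mathbb{R}^k$ is a closed, bounded, convex subset with nonempty interior; it is symmetric if $-v\in F$ whenever $v\in F$. $\lambda F+r=\{\lambda f+r:f\in F\}$. A finite set $S$ is shattered by a collection $\mathscr{F}$ if for every $A\subset S$ there is $K\in\mathscr{F}$ with $S\cap K=A$; the VC dimension of $\mathscr{F}$ is the supremum of cardinalities of finite sets shattered by $\mathscr{F}$. *)

theory Defs
  imports "HOL-Analysis.Analysis" "HOL-Library.Extended_Nat"
begin

definition convex_body :: "'a::euclidean_space set \<Rightarrow> bool" where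
  "convex_body K \<longleftrightarrow> closed K \<and> bounded K \<and> convex K \<and> interior K \<noteq> {}"

definition symmetric :: "'a::real_vector set \<Rightarrow> bool" where
  "symmetric F \<longleftrightarrow> (\<forall>v\<in>F. - v \<in> F)"

definition homothets :: "'a::real_vector set \<Rightarrow> 'a set set" where
  "homothets F = {(\<lambda>f. c *\<^sub>R f + r) ` F |c r. c > 0}"

definition shattered :: "'a set set \<Rightarrow> 'a set \<Rightarrow> bool" where
  "shattered \<F> S \<longleftrightarrow> (\<forall>A\<subseteq>S. \<exists>K\<in>\<F>. S \<inter> K = A)"

text \<open>The supremum is taken in the extended naturals, so an infinite VC dimension is the
  value \<open>\<infinity>\<close>.\<close>

definition vc_dim :: "'a set set \<Rightarrow> enat" where
  "vc_dim \<F> = (SUP S \<in> {S. finite S \<and> shattered \<F> S}. enat (card S))"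

end

(* Cut countably many small caps off the unit ball. Points placed on infinitely many parallel
   circles of the sphere can be chosen so that, up to sign, each of them is isolated from all
   the others; cutting a small symmetric pair of caps then removes any chosen subset of them from
   the ball without affecting the rest. The k-th circle carries a scaled copy of one fixed
   sequence of points, and from it we remove exactly the points whose indices lie in the k-th
   finite set of natural numbers. Rescaling the k-th circle back to the unit circle turns
   it into a homothet that cuts out the complement of that finite set. *)
theory Submission
  imports Defs "HOL-Library.Nat_Bijection"
begin

text \<open>For unit vectors the squared norms of \<open>z - y\<close> and \<open>z + y\<close> are
  2 - 2 (\<open>y \<bullet> z\<close>) and 2 + 2 (\<open>y \<bullet> z\<close>). Isolation up to
  sign therefore bounds \<bar>\<open>y \<bullet> z\<close>\<bar> away from 1 for all other
  \<open>z\<close> in \<open>D\<close>, so a slab orthogonal to \<open>y\<close> cuts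
  \<open>y\<close> off and keeps those \<open>z\<close>.\<close>

lemma ball_minus_caps:
  fixes D B :: "'a::euclidean_space set"
  assumes D: "D \<subseteq> sphere 0 1" and B: "B \<subseteq> D"
    and isolated: "\<And>y. y \<in> B \<Longrightarrow>
      \<exists>\<epsilon>>0. \<forall>z\<in>D. z \<noteq> y \<longrightarrow> \<epsilon> \<le> norm (z - y) \<and> \<epsilon> \<le> norm (z + y)"
  obtains F where "convex_body F" "symmetric F" "F \<inter> D = D - B"
proof -
  have "\<exists>c. 1/2 \<le> c \<and> c < 1 \<and> (\<forall>z\<in>D. z \<noteq> y \<longrightarrow> \<bar>y \<bullet> z\<bar> \<le> c)" if y: "y \<in> B" for y
  proof -
    from isolated[OF y] obtain \<epsilon> where \<epsilon>: "\<epsilon> > 0"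
      and sep: "\<And>z. z \<in> D \<Longrightarrow> z \<noteq> y \<Longrightarrow> \<epsilon> \<le> norm (z - y) \<and> \<epsilon> \<le> norm (z + y)"
      by blast
    have "\<bar>y \<bullet> z\<bar> \<le> 1 - \<epsilon>\<^sup>2 / 2" if z: "z \<in> D" "z \<noteq> y" for z
    proof -
      have unit: "y \<bullet> y = 1" "z \<bullet> z = 1"
        using y z D B by (auto simp: norm_eq_1)
      have "\<epsilon>\<^sup>2 \<le> (norm (z - y))\<^sup>2" "\<epsilon>\<^sup>2 \<le> (norm (z + y))\<^sup>2"
        using sep[OF z] \<epsilon> by (auto intro: power_mono)
      then show ?thesis
        using unit by (simp add: power2_norm_eq_inner inner_diff inner_add inner_commute abs_if)
    qed
    \<comment> \<open>The maximum with 1/2 keeps every slab wide enough to contain the ball of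
      radius 1/2, so that even infinitely many cuts leave a nonempty interior.\<close>
    then have "\<forall>z\<in>D. z \<noteq> y \<longrightarrow> \<bar>y \<bullet> z\<bar> \<le> max (1/2) (1 - \<epsilon>\<^sup>2 / 2)"
      by (auto simp: le_max_iff_disj)
    then show ?thesis
      using \<epsilon> by (intro exI[of _ "max (1/2) (1 - \<epsilon>\<^sup>2 / 2)"]) auto
  qed
  then obtain c where c: "\<And>y. y \<in> B \<Longrightarrow> 1/2 \<le> c y \<and> c y < 1"
    and avoid: "\<And>y z. y \<in> B \<Longrightarrow> z \<in> D \<Longrightarrow> z \<noteq> y \<Longrightarrow> \<bar>y \<bullet> z\<bar> \<le> c y"
    by metis
  define F where "F = cball 0 1 \<inter> (\<Inter>y\<in>B. {x. y \<bullet> x \<le> c y} \<inter> {x. y \<bullet> x \<ge> - c y})"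
  have "ball 0 (1/2) \<subseteq> F"
  proof
    fix x :: 'a assume x: "x \<in> ball 0 (1/2)"
    have "\<bar>y \<bullet> x\<bar> \<le> c y" if y: "y \<in> B" for y
    proof -
      have "norm y = 1" using y B D by auto
      then have "\<bar>y \<bullet> x\<bar> \<le> norm x"
        using Cauchy_Schwarz_ineq2[of y x] by simp
      also have "\<dots> \<le> 1/2" using x by simp
      finally show ?thesis using c[OF y] by linarith
    qed
    then show "x \<in> F" using x unfolding F_def by (fastforce simp: abs_le_iff)
  qed
  then have "interior F \<noteq> {}"
    using interior_maximal[OF _ open_ball, of 0 "1/2" F] by fastforce
  moreover have "closed F" unfolding F_def
    by (intro closed_Int closed_INT closed_cball ballI closed_halfspace_le closed_halfspace_ge)
  moreover have "bounded F" unfolding F_def by (intro bounded_Int disjI1 bounded_cball)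
  moreover have "convex F" unfolding F_def
    by (intro convex_Int convex_INT convex_cball convex_halfspace_le convex_halfspace_ge)
  ultimately have "convex_body F" by (simp add: convex_body_def)
  moreover have "symmetric F" by (auto simp: symmetric_def F_def minus_le_iff)
  moreover have "F \<inter> D = D - B"
  proof (intro equalityI subsetI)
    fix z assume z: "z \<in> F \<inter> D"
    have "z \<notin> B"
    proof
      assume zB: "z \<in> B"
      then have "z \<bullet> z \<le> c z" using z by (auto simp: F_def)
      moreover have "z \<bullet> z = 1" using z D by (auto simp: norm_eq_1)
      ultimately show False using c[OF zB] by simp
    qed
    then show "z \<in> D - B" using z by simp
  next
    fix z assume z: "z \<in> D - B"
    have "\<bar>y \<bullet> z\<bar> \<le> c y" if "y \<in> B" for y using avoid[OF that, of z] z that by auto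
    then show "z \<in> F \<inter> D" using z D unfolding F_def by (fastforce simp: abs_le_iff)
  qed
  ultimately show thesis by (rule that)
qed

text \<open>The gaps of the decreasing sequence 1/(n+2) shrink, so the nearest other term to 1/(k+2)
  is its successor 1/(k+3); the bound is exactly that distance.\<close>

lemma inverse_nat_gap:
  fixes k l :: nat
  assumes "l \<noteq> k"
  shows "1 / ((real k + 2) * (real k + 3)) \<le> \<bar>1 / (real l + 2) - 1 / (real k + 2)\<bar>"
proof (cases "l < k")
  case True
  then have "real l + 1 \<le> real k" by linarith
  then have "1 / (real k + 1) \<le> 1 / (real l + 2)"
    by (simp add: field_simps)
  moreover have "1 / (real k + 1) - 1 / (real k + 2) = 1 / ((real k + 1) * (real k + 2))"
    by (simp add: field_simps)
  moreover have "1 / ((real k + 2) * (real k + 3)) \<le> 1 / ((real k + 1) * (real k + 2))"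
    by (intro divide_left_mono mult_pos_pos) (auto simp: algebra_simps)
  ultimately show ?thesis by linarith
next
  case False
  then have "real k + 1 \<le> real l" using assms by linarith
  then have "1 / (real l + 2) \<le> 1 / (real k + 3)" by (simp add: field_simps)
  moreover have "1 / (real k + 2) - 1 / (real k + 3) = 1 / ((real k + 2) * (real k + 3))"
    by (simp add: field_simps)
  ultimately show ?thesis by linarith
qed

lemma vc_dim_eq_infinity:
  assumes "\<And>n. \<exists>S. finite S \<and> card S = n \<and> shattered \<F> S"
  shows "vc_dim \<F> = \<infinity>"
proof -
  have "enat n \<le> vc_dim \<F>" for n
    using assms[of n] unfolding vc_dim_def by (auto intro: SUP_upper2)
  then show ?thesis by (metis enat_ord_simps(2) linorder_not_less lessI not_infinity_eq)
qed

lemma symmetric_convex_body_infinite_vc_dim: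
  assumes "DIM('a::euclidean_space) \<ge> 3"
  shows "\<exists>F :: 'a set. convex_body F \<and> symmetric F \<and> vc_dim (homothets F) = \<infinity>"
proof -
  \<comment> \<open>Two orthonormal directions span the plane of the model circle; the third is the
    axis along which its scaled copies are stacked.\<close>
  obtain T :: "'a set" where "T \<subseteq> Basis" "card T = 3"
    using assms by (rule obtain_subset_with_card_n)
  then obtain e1 e2 e3 :: 'a where e: "{e1, e2, e3} \<subseteq> Basis" "e1 \<noteq> e2" "e1 \<noteq> e3" "e2 \<noteq> e3"
    by (metis card_3_iff)
  have inner_e: "e1 \<bullet> e1 = 1" "e2 \<bullet> e2 = 1" "e3 \<bullet> e3 = 1" "e1 \<bullet> e2 = 0" "e2 \<bullet> e1 = 0"
    "e1 \<bullet> e3 = 0" "e3 \<bullet> e1 = 0" "e2 \<bullet> e3 = 0" "e3 \<bullet> e2 = 0"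
    using e by (auto simp: inner_Basis)
  have norm_e: "norm e1 = 1" "norm e3 = 1" using e by auto
  \<comment> \<open>This sequence serves both as the heights of the circles and as the
    \<open>e1\<close>-coordinates of the points on the model circle. The shift by 2 keeps it
    strictly between 0 and 1, so every radius \<open>w k\<close> is positive.\<close>
  define u where "u k = 1 / (real k + 2)" for k :: nat
  define w where "w k = sqrt (1 - (u k)\<^sup>2)" for k
  define p where "p i = u i *\<^sub>R e1 + w i *\<^sub>R e2" for i
  define x where "x k i = w k *\<^sub>R p i + u k *\<^sub>R e3" for k i
  define g where "g k = 1 / ((real k + 2) * (real k + 3))" for k :: nat
  have g: "g k > 0" "l \<noteq> k \<Longrightarrow> g k \<le> \<bar>u l - u k\<bar>" for k l
    using inverse_nat_gap by (auto simp: g_def u_def)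
  have u: "0 < u k" "u k < 1" for k by (auto simp: u_def)
  then have u2: "(u k)\<^sup>2 < 1" for k
    by (simp add: abs_square_less_1 abs_of_pos)
  then have w: "0 < w k" "(w k)\<^sup>2 = 1 - (u k)\<^sup>2" for k
    using less_imp_le[OF u2[of k]] by (auto simp: w_def)
  have x_e1: "x k i \<bullet> e1 = w k * u i" and x_e3: "x k i \<bullet> e3 = u k" for k i
    by (auto simp: x_def p_def inner_add inner_e)
  have p_e1: "p i \<bullet> e1 = u i" for i by (auto simp: p_def inner_add inner_e)
  have u_inj: "u k = u l \<longleftrightarrow> k = l" for k l by (simp add: u_def)
  have x_inj: "x k i = x l j \<longleftrightarrow> k = l \<and> i = j" for k i l j
  proof
    assume eq: "x k i = x l j"
    then have "k = l" by (metis x_e3 u_inj)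
    moreover have "w k * u i = w l * u j" using eq by (metis x_e1)
    ultimately show "k = l \<and> i = j" using w(1)[of l] by (simp add: u_inj)
  qed simp
  define D where "D = range (\<lambda>(k, i). x k i)"
  \<comment> \<open>\<open>set_decode\<close> reaches every finite set of naturals, so a single body
    will encode all of them.\<close>
  define B where "B = (\<lambda>(k, i). x k i) ` {(k, i). i \<in> set_decode k}"
  have "norm (x k i) = 1" for k i
  proof -
    have "x k i \<bullet> x k i = (w k)\<^sup>2 * ((u i)\<^sup>2 + (w i)\<^sup>2) + (u k)\<^sup>2"
      by (simp add: x_def p_def inner_add inner_e power2_eq_square algebra_simps)
    then show ?thesis using w(2) by (simp add: norm_eq_1)
  qed
  then have "D \<subseteq> sphere 0 1" by (auto simp: D_def)
  moreover have BD: "B \<subseteq> D" by (auto simp: B_def D_def)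
  moreover have "\<exists>\<epsilon>>0. \<forall>z\<in>D. z \<noteq> y \<longrightarrow> \<epsilon> \<le> norm (z - y) \<and> \<epsilon> \<le> norm (z + y)" if "y \<in> B" for y
  proof -
    obtain k i where y: "y = x k i" using \<open>y \<in> B\<close> BD unfolding D_def by fast
    \<comment> \<open>One term for each way of being close: \<open>u k\<close> separates
      \<open>z\<close> from \<open>- y\<close>, as all heights are positive; \<open>g k\<close>
      separates different circles by height; \<open>w k * g i\<close> separates points of one circle
      by their \<open>e1\<close>-coordinates, which are scaled by the radius.\<close>
    define \<epsilon> where "\<epsilon> = min (u k) (min (g k) (w k * g i))"
    have "\<epsilon> \<le> norm (z - y)" "\<epsilon> \<le> norm (z + y)" if z: "z \<in> D" "z \<noteq> y" for z
    proof -
      obtain l j where zlj: "z = x l j" using z unfolding D_def by fast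
      have e3: "\<bar>v \<bullet> e3\<bar> \<le> norm v" and e1: "\<bar>v \<bullet> e1\<bar> \<le> norm v" for v
        using Cauchy_Schwarz_ineq2[of v e3] Cauchy_Schwarz_ineq2[of v e1] norm_e by auto
      show "\<epsilon> \<le> norm (z + y)"
        using e3[of "z + y"] u(1)[of k] u(1)[of l]
        by (simp add: zlj y inner_add x_e3 \<epsilon>_def)
      show "\<epsilon> \<le> norm (z - y)"
      proof (cases "l = k")
        case True
        then have "j \<noteq> i" using z zlj y by auto
        then have "w k * g i \<le> w k * \<bar>u j - u i\<bar>" using g(2) w(1)[of k] by simp
        also have "\<dots> = \<bar>(z - y) \<bullet> e1\<bar>"
          using w(1)[of k] True
          by (simp add: zlj y inner_diff x_e1 abs_mult flip: right_diff_distrib)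
        also have "\<dots> \<le> norm (z - y)" by (rule e1)
        finally show ?thesis by (simp add: \<epsilon>_def)
      next
        case False
        then show ?thesis
          using e3[of "z - y"] g(2)[of l k] by (simp add: zlj y inner_diff x_e3 \<epsilon>_def)
      qed
    qed
    moreover have "\<epsilon> > 0" using u g w by (simp add: \<epsilon>_def)
    ultimately show ?thesis by blast
  qed
  ultimately obtain F where F: "convex_body F" "symmetric F" and FD: "F \<inter> D = D - B"
    using ball_minus_caps[of D B] by metis
  have x_in_F: "x k i \<in> F \<longleftrightarrow> i \<notin> set_decode k" for k i
  proof -
    \<comment> \<open>Injectivity matters here: no other pair of indices can put the same point into
      \<open>B\<close>.\<close>
    have "x k i \<in> D" "x k i \<in> B \<longleftrightarrow> i \<in> set_decode k" using x_inj by (auto simp: D_def B_def)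
    then show ?thesis using FD by blast
  qed
  have "\<exists>S. finite S \<and> card S = n \<and> shattered (homothets F) S" for n
  proof (intro exI conjI)
    have "inj p" using p_e1 u_inj by (metis injI)
    then show "card (p ` {..<n}) = n" by (simp add: card_image inj_on_subset)
    show "shattered (homothets F) (p ` {..<n})"
      unfolding shattered_def
    proof (intro allI impI)
      fix A assume A: "A \<subseteq> p ` {..<n}"
      \<comment> \<open>The code is that of the indices to be left out, since \<open>F\<close>
        misses exactly the points of circle \<open>k\<close> whose indices are in
        \<open>set_decode k\<close>.\<close>
      define k where "k = set_encode {i. i < n \<and> p i \<notin> A}"
      \<comment> \<open>This map inverts v \<mapsto>
        \<open>w k *\<^sub>R v + u k *\<^sub>R e3\<close>, which carries the model circle onto
        circle \<open>k\<close> and \<open>p i\<close> to \<open>x k i\<close>.\<close>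
      define K where "K = (\<lambda>f. (1 / w k) *\<^sub>R f + (- (u k / w k)) *\<^sub>R e3) ` F"
      have "p i \<in> K \<longleftrightarrow> x k i \<in> F" for i
      proof
        assume "p i \<in> K"
        then obtain f where f: "f \<in> F" "p i = (1 / w k) *\<^sub>R f + (- (u k / w k)) *\<^sub>R e3"
          by (auto simp: K_def)
        then have "x k i = f"
          using w(1)[of k] by (simp add: x_def f(2) scaleR_diff_right)
        then show "x k i \<in> F" using f by simp
      next
        assume "x k i \<in> F"
        moreover have "p i = (1 / w k) *\<^sub>R x k i + (- (u k / w k)) *\<^sub>R e3"
          using w(1)[of k] by (simp add: x_def algebra_simps)
        ultimately show "p i \<in> K" unfolding K_def by blast
      qed
      then have "p i \<in> K \<longleftrightarrow> p i \<in> A" if "i < n" for i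
        using that by (simp add: x_in_F k_def)
      then have "p ` {..<n} \<inter> K = A" using A by auto
      moreover have "K \<in> homothets F"
        using w(1)[of k] unfolding homothets_def K_def
        by (intro CollectI exI[of _ "1 / w k"] exI[of _ "(- (u k / w k)) *\<^sub>R e3"]) auto
      ultimately show "\<exists>K\<in>homothets F. p ` {..<n} \<inter> K = A" by blast
    qed
  qed simp
  then show ?thesis using F vc_dim_eq_infinity by blast
qed

theorem theorem13:
  assumes "CARD('d::finite) \<ge> 3"
    and "CARD('e::finite) = CARD('d) - 1"
    and "vc_dim {K :: (real ^ 'e) set. convex_body K} = \<infinity>"
  shows "\<exists>F :: (real ^ 'd) set. convex_body F \<and> symmetric F \<and> vc_dim (homothets F) = \<infinity>"
  using symmetric_convex_body_infinite_vc_dim[where 'a = "real ^ 'd"] assms(1) by simp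

end
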